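(* Let $n$ and $k$ be integers with $3\le k< n/2$ and \[ n\ge\begin{cases} 8, & k=3,\\ 10, & k=4,\\ \frac{k(k+1)}{2}, & k \text{ odd and } k\ge 5,\\ \frac{k^2}{2}, & k \text{ even and } k\ge 6. \end{cases} \] Then the following hold (all $m,j$ below are integers with $m\ge 0$). \begin{enumerate} \item If $k\ge 3$, $k$ odd, $n$ even, and $\frac{n}{2}=mk+j$ with $\frac{k-1}{2}\le j<k$, then ${\rm diam}(GP(n,k))$ equals $m+2+j$ if $j=\frac{k-1}{2}$ or $j=\frac{k+1}{2}$; equals $m+3+k-j$ if $3\le 2j-k\le\frac{k+1}{2}$; equals $m+2+j-\frac{k-1}{2}$ if $2j-k>\frac{k+1}{2}$. \item If $k\ge 3$, $k$ odd, $n$ even, and $\frac{n}{2}=mk+j$ with $0\le j<\frac{k-1}{2}$, then ${\rm diam}(GP(n,k))$ equals $m+1+\frac{k+1}{2}$ if $j=0$ or $j=1$; equals $m+3+\frac{k-1}{2}-j$ if $4\le 2j\le\frac{k+1}{2}$; equals $m+2+j$ if $2j>\frac{k+1}{2}$. \item If $k\ge 3$, $k$ odd, $n$ odd, and $\frac{n-1}{2}=mk+j$ with $\frac{k-2}{2}\le j<k$, then ${\rm diam}(GP(n,k))$ equals $m+2+\frac{k-1}{2}$ if $j=\frac{k-1}{2}$; equals $m+2+k-j$ if $2\le 2j+1-k\le\frac{k+1}{2}$; equals $m+2+j-\frac{k-1}{2}$ if $2j+1-k>\frac{k+1}{2}$. \item If $k\ge 3$, $k$ odd, $n$ odd, and $\frac{n-1}{2}=mk+j$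 with $0\le j<\frac{k-2}{2}$, then ${\rm diam}(GP(n,k))$ equals $m+2+\frac{k-1}{2}-j$ if $1\le 2j+1\le\frac{k+1}{2}$; equals $m+2+j$ if $2j+1>\frac{k+1}{2}$. \item If $k\ge 4$, $k$ even, $n$ even, and $\frac{n}{2}=mk+j$ with $\frac{k-2}{2}\le j<k$, then ${\rm diam}(GP(n,k))$ equals $m+2+j$ if $j=\frac{k-2}{2}$ or $j=\frac{k}{2}$; equals $m+3+k-j$ if $2\le 2j-k\le\frac{k}{2}$; equals $m+2+j-\frac{k}{2}$ if $2j-k\ge\frac{k+2}{2}$. \item If $k\ge 4$, $k$ even, $n$ even, and $\frac{n}{2}=mk+j$ with $0\le j<\frac{k-2}{2}$, then ${\rm diam}(GP(n,k))$ equals $m+1+\frac{k}{2}$ if $j=0$; equals $m+2+\frac{k}{2}-j$ if $2\le 2j\le\frac{k}{2}$; equals $m+2+j$ if $2j\ge\frac{k+2}{2}$. \item If $k\ge 4$, $k$ even, $n$ odd, and $\frac{n-1}{2}=mk+j$ with $\frac{k-3}{2}\le j<k$, then ${\rm diam}(GP(n,k))$ equals $m+2+\frac{k-2}{2}$ if $j=\frac{k-2}{2}$; equals $m+2+k-j$ if $1\le 2j+1-k\le\frac{k}{2}$; equals $m+3+j-\frac{k}{2}$ if $2j+1-k\ge\frac{k+2}{2}$. \item If $k\ge 4$, $k$ even, $n$ odd, and $\frac{n-1}{2}=mk+j$ with $0\le j<\frac{k-3}{2}$, then ${\rm diam}(GP(n,k))$ equals $m+1+\frac{k}{2}$ if $j=0$;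 equals $m+2+\frac{k}{2}-j$ if $3\le 2j+1\le\frac{k}{2}$; equals $m+2+j$ if $2j+1\ge\frac{k+2}{2}$. \end{enumerate}
   Context: For $n\ge 3$ and $1\le k<n/2$, the generalized Petersen graph $GP(n,k)$ has vertex set $\{u_i: i\in\mathbb{Z}_n\}\cup\{v_i: i\in\mathbb{Z}_n\}$ and edge set $\{u_iu_{i+1}: i\in\mathbb{Z}_n\}\cup\{v_iv_{i+k}: i\in\mathbb{Z}_n\}\cup\{u_iv_i: i\in\mathbb{Z}_n\}$ (indices mod $n$). ${\rm diam}(G)$ denotes the diameter (maximum shortest-path distance) of a connected graph $G$. *)

theory Defs
  imports "Graph_Theory.Graph_Theory"
begin

datatype gp_vertex = U int | V int

definition gp_verts :: "int \<Rightarrow> gp_vertex set" where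
  "gp_verts n = U ` {0..<n} \<union> V ` {0..<n}"

text \<open>The residue class of an index modulo \<open>n\<close> is represented by its element of \<open>{0..<n}\<close>.\<close>

definition gp_edges :: "int \<Rightarrow> int \<Rightarrow> gp_vertex set set" where
  "gp_edges n k =
     {{U i, U ((i + 1) mod n)} | i. i \<in> {0..<n}} \<union>
     {{V i, V ((i + k) mod n)} | i. i \<in> {0..<n}} \<union>
     {{U i, V i} | i. i \<in> {0..<n}}"

text \<open>As usual in \<open>Graph_Theory\<close>, an undirected graph is a symmetric digraph: each edge
  \<open>{x, y}\<close> becomes the two arcs \<open>(x, y)\<close> and \<open>(y, x)\<close>.\<close>

definition GP :: "int \<Rightarrow> int \<Rightarrow> gp_vertex pair_pre_digraph" where
  "GP n k = \<lparr> pverts = gp_verts n, parcs = {(x, y). {x, y} \<in> gp_edges n k} \<rparr>"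

text \<open>The library's shortest-path distance \<open>\<mu>\<close>, taken with unit weights, is the usual
  distance. It is \<open>\<infinity>\<close> for unreachable pairs, so a nonempty finite graph has a finite
  diameter iff it is (strongly) connected, and then the supremum is a maximum.\<close>

definition diam :: "('a, 'b) pre_digraph \<Rightarrow> ereal" where
  "diam G = (SUP (x, y) \<in> verts G \<times> verts G. wf_digraph.\<mu> G (\<lambda>_. 1) x y)"

lemma pair_graph_GP:
  assumes "n \<ge> 3" "1 \<le> k" "2 * k < n"
  shows "pair_graph (GP n k)"
proof -
  have ends: "x \<in> gp_verts n \<and> y \<in> gp_verts n" if "{x, y} \<in> gp_edges n k" for x y
    using that assms by (auto simp: gp_edges_def gp_verts_def doubleton_eq_iff)
  have *: "(i + d) mod n \<noteq> i" if "0 \<le> i" "i < n" "1 \<le> d" "d < n" for i d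
  proof
    assume "(i + d) mod n = i"
    then have "(i + d) mod n = i mod n" using that by simp
    then have "n dvd d" by (simp add: mod_eq_dvd_iff)
    then show False using that zdvd_imp_le by fastforce
  qed
  have irrefl: "{x, x} \<notin> gp_edges n k" for x
    using *[of _ 1] *[of _ k] assms by (fastforce simp: gp_edges_def doubleton_eq_iff)
  have fin: "finite (gp_verts n)" by (simp add: gp_verts_def)
  have "{(x, y). {x, y} \<in> gp_edges n k} \<subseteq> gp_verts n \<times> gp_verts n"
    using ends by auto
  then have fina: "finite {(x, y). {x, y} \<in> gp_edges n k}"
    by (rule finite_subset) (simp add: fin)
  show ?thesis
    using ends irrefl fin fina
    by unfold_locales
      (auto simp: GP_def symmetric_def sym_def insert_commute dest: ends)
qed

end

theory Submission
  imports Defs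
begin

text \<open>
  A walk with net displacement \<open>a\<close> on the outer cycle and \<open>b\<close> inner steps joins indices differing by
  \<open>a + b k\<close> modulo \<open>n\<close>, and costs \<open>\<bar>a\<bar> + \<bar>b\<bar>\<close> plus its spokes. Let \<open>F\<close> be the maximum over all
  residues of the minimal \<open>\<bar>a\<bar> + \<bar>b\<bar>\<close>, that is, the diameter of the circulant graph on \<open>1\<close> and \<open>k\<close>.
  Two spokes always suffice, so the diameter is at most \<open>F + 2\<close>; a residue attaining \<open>F\<close> whose cyclic
  distance from \<open>0\<close> is at least \<open>F + 2\<close> forces both spokes between two outer vertices.

  With \<open>n = 2 m k + J\<close> and \<open>0 \<le> J < 2 k\<close>, rounding to the two nearest multiples of \<open>k\<close>, from \<open>x\<close> or
  from \<open>n - x\<close>, gives the upper bound \<open>F \<le> m + G\<close>. For the lower bound the extremal residue is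
  \<open>m k + s\<close> with \<open>s\<close> one of \<open>G\<close>, \<open>- G\<close>, \<open>\<lfloor>J / 2\<rfloor>\<close>; the size hypothesis on \<open>n\<close> excludes
  representations that go around the cycle more than once.
\<close>

section \<open>Distance and diameter through powers of the arc relation\<close>

lemma relpow_trans: "(x, y) \<in> R ^^ p \<Longrightarrow> (y, z) \<in> R ^^ q \<Longrightarrow> (x, z) \<in> R ^^ (p + q)"
  by (auto simp: relpow_add)

lemma awalk_imp_relpow:
  "pre_digraph.awalk (with_proj G) x p y \<Longrightarrow> (x, y) \<in> parcs G ^^ length p"
proof -
  have "pcas x p y \<Longrightarrow> set p \<subseteq> parcs G \<Longrightarrow> (x, y) \<in> parcs G ^^ length p"
    by (induction p arbitrary: x) (auto simp del: relpow.simps(2) intro: relpow_Suc_I2 simp: relpow_0_I)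
  then show "pre_digraph.awalk (with_proj G) x p y \<Longrightarrow> (x, y) \<in> parcs G ^^ length p"
    by (simp add: pre_digraph.awalk_def cas_with_proj_eq)
qed

lemma relpow_imp_awalk:
  "x \<in> pverts G \<Longrightarrow> (x, y) \<in> parcs G ^^ l \<Longrightarrow>
    \<exists>p. pre_digraph.awalk (with_proj G) x p y \<and> length p = l"
proof -
  have "(x, y) \<in> parcs G ^^ l \<Longrightarrow> \<exists>p. pcas x p y \<and> set p \<subseteq> parcs G \<and> length p = l"
  proof (induction l arbitrary: x)
    case 0
    then show ?case by (intro exI[of _ "[]"]) simp
  next
    case (Suc l)
    then obtain z where z: "(x, z) \<in> parcs G" "(z, y) \<in> parcs G ^^ l"
      by (meson relpow_Suc_D2)
    with Suc.IH obtain p where "pcas z p y" "set p \<subseteq> parcs G" "length p = l" by blast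
    with z(1) show ?case by (intro exI[of _ "(x, z) # p"]) simp
  qed
  then show "x \<in> pverts G \<Longrightarrow> (x, y) \<in> parcs G ^^ l \<Longrightarrow>
    \<exists>p. pre_digraph.awalk (with_proj G) x p y \<and> length p = l"
    by (auto simp: pre_digraph.awalk_def cas_with_proj_eq)
qed

lemma unit_distance_le:
  assumes "wf_digraph (with_proj G)" "x \<in> pverts G" "(x, y) \<in> parcs G ^^ l"
  shows "wf_digraph.\<mu> (with_proj G) (\<lambda>_. 1) x y \<le> ereal (real l)"
proof -
  obtain p where "pre_digraph.awalk (with_proj G) x p y" "length p = l"
    using relpow_imp_awalk assms by metis
  then show ?thesis
    using wf_digraph.min_cost_le_walk_cost[OF assms(1), of x p y "\<lambda>_. 1"]
    by (simp add: wf_digraph.awalk_cost_def[OF assms(1)] sum_list_triv)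
qed

lemma unit_distance_ge:
  assumes "wf_digraph (with_proj G)" "\<And>l. (x, y) \<in> parcs G ^^ l \<Longrightarrow> D \<le> l"
  shows "ereal (real D) \<le> wf_digraph.\<mu> (with_proj G) (\<lambda>_. 1) x y"
  unfolding wf_digraph.\<mu>_def[OF assms(1)]
proof (rule INF_greatest)
  fix p assume "p \<in> {p. pre_digraph.awalk (with_proj G) x p y}"
  then have "(x, y) \<in> parcs G ^^ length p" by (simp add: awalk_imp_relpow)
  then have "D \<le> length p" by (rule assms(2))
  then show "ereal (real D) \<le> ereal (wf_digraph.awalk_cost (\<lambda>_. 1) p)"
    by (simp add: wf_digraph.awalk_cost_def[OF assms(1)] sum_list_triv)
qed

text \<open>Powers of the arc relation count exact lengths. Hence the upper bound asks for some
  \<open>l \<le> D\<close> for each pair, while the lower bound rules out every shorter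
  \<open>l\<close> for the single pair \<open>x0\<close>, \<open>y0\<close>, which is enough for the
  supremum.\<close>

lemma diam_eqI:
  assumes "wf_digraph (with_proj G)"
    and "\<And>x y. x \<in> pverts G \<Longrightarrow> y \<in> pverts G \<Longrightarrow> \<exists>l\<le>D. (x, y) \<in> parcs G ^^ l"
    and "x0 \<in> pverts G" "y0 \<in> pverts G" "\<And>l. (x0, y0) \<in> parcs G ^^ l \<Longrightarrow> D \<le> l"
  shows "diam (with_proj G) = ereal (real D)"
proof (rule antisym)
  show "diam (with_proj G) \<le> ereal (real D)"
    unfolding diam_def
  proof (rule SUP_least, clarsimp)
    fix x y assume xy: "x \<in> pverts G" "y \<in> pverts G"
    with assms(2) obtain l where l: "l \<le> D" "(x, y) \<in> parcs G ^^ l" by blast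
    from unit_distance_le[OF assms(1) xy(1) l(2)] l(1)
    show "wf_digraph.\<mu> (with_proj G) (\<lambda>_. 1) x y \<le> ereal (real D)"
      by (meson ereal_less_eq(3) of_nat_mono order_trans)
  qed
  have "ereal (real D) \<le> wf_digraph.\<mu> (with_proj G) (\<lambda>_. 1) x0 y0"
    using unit_distance_ge assms by metis
  also have "\<dots> \<le> diam (with_proj G)"
    unfolding diam_def using assms(3,4) by (intro SUP_upper2[of "(x0, y0)"]) auto
  finally show "ereal (real D) \<le> diam (with_proj G)" .
qed

section \<open>Upper bound: walks with prescribed displacement\<close>

lemma GP_simps:
  "pverts (GP n k) = gp_verts n" "(x, y) \<in> parcs (GP n k) \<longleftrightarrow> {x, y} \<in> gp_edges n k"
  by (simp_all add: GP_def)

lemma GP_sym: "(x, y) \<in> parcs (GP n k) \<Longrightarrow> (y, x) \<in> parcs (GP n k)"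
  by (simp add: GP_simps insert_commute)

text \<open>The starting index is an arbitrary integer reduced \<open>mod n\<close>, so that walks
  can be followed over the integers without wraparound cases.\<close>

lemma GP_arcs:
  assumes "0 < n"
  shows "(U (x mod n), U ((x + 1) mod n)) \<in> parcs (GP n k)"
    and "(V (x mod n), V ((x + k) mod n)) \<in> parcs (GP n k)"
    and "(U (x mod n), V (x mod n)) \<in> parcs (GP n k)"
proof -
  have *: "x mod n \<in> {0..<n}" using assms by simp
  show "(U (x mod n), U ((x + 1) mod n)) \<in> parcs (GP n k)"
    unfolding GP_simps gp_edges_def using *
    by (intro UnI1 CollectI exI[of _ "x mod n"]) (simp add: mod_simps)
  show "(V (x mod n), V ((x + k) mod n)) \<in> parcs (GP n k)"
    unfolding GP_simps gp_edges_def using *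
    by (intro UnI1[OF UnI2] CollectI exI[of _ "x mod n"]) (simp add: mod_simps)
  show "(U (x mod n), V (x mod n)) \<in> parcs (GP n k)"
    unfolding GP_simps gp_edges_def using *
    by (intro UnI2 CollectI exI[of _ "x mod n"]) simp
qed

text \<open>Used with \<open>f\<close> the outer or inner indexing and \<open>d\<close> equal to
  \<open>1\<close> or \<open>k\<close>. A negative \<open>b\<close> walks backwards, which is where
  symmetry of \<open>R\<close> enters.\<close>

lemma relpow_multiple:
  fixes d x b :: int
  assumes "\<And>x. (f x, f (x + d)) \<in> R" "sym R"
  shows "(f x, f (x + b * d)) \<in> R ^^ nat \<bar>b\<bar>"
proof -
  have up: "(f x, f (x + int l * d)) \<in> R ^^ l" for x l
  proof (induction l)
    case (Suc l)
    then show ?case using assms(1)[of "x + int l * d"]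
      by (auto simp: algebra_simps)
  qed simp
  have down: "(f x, f (x - int l * d)) \<in> R ^^ l" for x l
  proof (induction l)
    case (Suc l)
    have "(f (x - int l * d), f (x - int (Suc l) * d)) \<in> R"
      using assms(1)[of "x - int (Suc l) * d"] symD[OF assms(2)] by (simp add: algebra_simps)
    with Suc show ?case by auto
  qed simp
  show ?thesis
    using up[of x "nat b"] down[of x "nat (- b)"] by (cases "b \<ge> 0") auto
qed

text \<open>All outer steps are grouped together, and so are all inner steps. Choosing which group
  comes first lets endpoints of different kinds use one spoke and endpoints of the same kind
  two.\<close>

lemma GP_walk_length:
  assumes "0 < n" "x \<in> gp_verts n" "y \<in> gp_verts n"
    and "\<And>x. \<exists>a b. n dvd x - (a + b * k) \<and> \<bar>a\<bar> + \<bar>b\<bar> \<le> F"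
  shows "\<exists>l\<le>nat (F + 2). (x, y) \<in> parcs (GP n k) ^^ l"
proof -
  let ?R = "parcs (GP n k)"
  have sym: "sym ?R" using GP_sym by (auto simp: sym_def)
  have U: "(U (x mod n), U ((x + a) mod n)) \<in> ?R ^^ nat \<bar>a\<bar>" for x a
    using relpow_multiple[of "\<lambda>x. U (x mod n)" 1 ?R x a] GP_arcs(1)[OF assms(1)] sym by simp
  have V: "(V (x mod n), V ((x + b * k) mod n)) \<in> ?R ^^ nat \<bar>b\<bar>" for x b
    using relpow_multiple[of "\<lambda>x. V (x mod n)" k ?R x b] GP_arcs(2)[OF assms(1)] sym by simp
  have UV: "(U (x mod n), V (x mod n)) \<in> ?R ^^ 1" for x
    using GP_arcs(3)[OF assms(1)] by simp
  have VU: "(V (x mod n), U (x mod n)) \<in> ?R ^^ 1" for x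
    using GP_arcs(3)[OF assms(1)] GP_sym by simp
  have idx: "\<exists>i. z = U (i mod n) \<or> z = V (i mod n)" if "z \<in> gp_verts n" for z
    using that by (force simp: gp_verts_def intro: mod_pos_pos_trivial[symmetric])
  obtain i where i: "x = U (i mod n) \<or> x = V (i mod n)" using idx assms by blast
  obtain i' where i': "y = U (i' mod n) \<or> y = V (i' mod n)" using idx assms by blast
  obtain a b where "n dvd (i' - i) - (a + b * k)" and F: "\<bar>a\<bar> + \<bar>b\<bar> \<le> F" using assms(4) by blast
  then have e: "(i + a + b * k) mod n = i' mod n" "(i + b * k + a) mod n = i' mod n"
    by (simp_all add: mod_eq_dvd_iff algebra_simps dvd_diff_commute)
  \<comment> \<open>Two outer endpoints: enter at once, do the inner steps, leave, then do the outer
    steps. Two inner endpoints use the mirror order, hence the two forms in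
    \<open>e\<close>.\<close>
  have "(U (i mod n), U (i' mod n)) \<in> ?R ^^ (1 + (nat \<bar>b\<bar> + (1 + nat \<bar>a\<bar>)))"
    using UV V VU U e by (metis relpow_trans)
  moreover have "(V (i mod n), V (i' mod n)) \<in> ?R ^^ (1 + (nat \<bar>a\<bar> + (1 + nat \<bar>b\<bar>)))"
    using UV V VU U e by (metis relpow_trans)
  moreover have "(U (i mod n), V (i' mod n)) \<in> ?R ^^ (nat \<bar>a\<bar> + (1 + nat \<bar>b\<bar>))"
    using UV V VU U e by (metis relpow_trans)
  moreover have "(V (i mod n), U (i' mod n)) \<in> ?R ^^ (nat \<bar>b\<bar> + (1 + nat \<bar>a\<bar>))"
    using UV V VU U e by (metis relpow_trans)
  moreover have "1 + (nat \<bar>b\<bar> + (1 + nat \<bar>a\<bar>)) \<le> nat (F + 2)" "1 + (nat \<bar>a\<bar> + (1 + nat \<bar>b\<bar>)) \<le> nat (F + 2)"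
    "nat \<bar>b\<bar> + (1 + nat \<bar>a\<bar>) \<le> nat (F + 2)" "nat \<bar>a\<bar> + (1 + nat \<bar>b\<bar>) \<le> nat (F + 2)"
    using F by auto
  ultimately show ?thesis using i i' by metis
qed

section \<open>Lower bound: what a walk between outer vertices must pay\<close>

text \<open>What a walk of length at most \<open>l\<close> from \<open>U 0\<close> can reach: an inner step costs one spoke if the walk
  ends inside and two if it ends outside.\<close>

fun gp_reach :: "int \<Rightarrow> int \<Rightarrow> nat \<Rightarrow> gp_vertex \<Rightarrow> bool" where
  "gp_reach n k l (U i) \<longleftrightarrow>
    (\<exists>a b. n dvd i - (a + b * k) \<and> \<bar>a\<bar> + \<bar>b\<bar> + (if b = 0 then 0 else 2) \<le> int l)"
| "gp_reach n k l (V i) \<longleftrightarrow> (\<exists>a b. n dvd i - (a + b * k) \<and> \<bar>a\<bar> + \<bar>b\<bar> + 1 \<le> int l)"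

text \<open>Entering turns the spoke charge 0 or 2 into 1, and leaving turns 1 into 0 or 2, so a
  spoke raises it by at most 1. Any other arc keeps the charge or lowers it, and moves one of
  \<open>a\<close>, \<open>b\<close> by 1.\<close>

lemma gp_reach_step:
  assumes "gp_reach n k l x" "(x, y) \<in> parcs (GP n k)"
  shows "gp_reach n k (Suc l) y"
proof -
  \<comment> \<open>Removes the reduction \<open>mod n\<close> of the far endpoint of a cycle arc,
    which divisibility by \<open>n\<close> does not see.\<close>
  have eq: "n dvd (i + d) mod n - c \<longleftrightarrow> n dvd i + d - c" for i d c :: int
    by (metis mod_diff_left_eq dvd_eq_mod_eq_0)
  from assms(2) consider i where "x = U i" "y = U ((i + 1) mod n)" 
    | i where "y = U i" "x = U ((i + 1) mod n)"
    | i where "x = V i" "y = V ((i + k) mod n)" 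
    | i where "y = V i" "x = V ((i + k) mod n)"
    | i where "x = U i" "y = V i" | i where "x = V i" "y = U i"
    by (auto simp: GP_simps gp_edges_def doubleton_eq_iff)
  then show ?thesis
  proof cases
    case 1
    with assms(1) obtain a b where "n dvd i - (a + b * k)" "\<bar>a\<bar> + \<bar>b\<bar> + (if b = 0 then 0 else 2) \<le> int l"
      by auto
    then show ?thesis unfolding 1 gp_reach.simps eq
      by (intro exI[of _ "a + 1"] exI[of _ b]) (auto simp: algebra_simps)
  next
    case 2
    with assms(1) obtain a b where "n dvd i + 1 - (a + b * k)" "\<bar>a\<bar> + \<bar>b\<bar> + (if b = 0 then 0 else 2) \<le> int l"
      by (auto simp: eq)
    then show ?thesis unfolding 2 gp_reach.simps
      by (intro exI[of _ "a - 1"] exI[of _ b]) (auto simp: algebra_simps)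
  next
    case 3
    with assms(1) obtain a b where "n dvd i - (a + b * k)" "\<bar>a\<bar> + \<bar>b\<bar> + 1 \<le> int l"
      by auto
    then show ?thesis unfolding 3 gp_reach.simps eq
      by (intro exI[of _ a] exI[of _ "b + 1"]) (auto simp: algebra_simps)
  next
    case 4
    with assms(1) obtain a b where "n dvd i + k - (a + b * k)" "\<bar>a\<bar> + \<bar>b\<bar> + 1 \<le> int l"
      by (auto simp: eq)
    then show ?thesis unfolding 4 gp_reach.simps
      by (intro exI[of _ a] exI[of _ "b - 1"]) (auto simp: algebra_simps)
  next
    case 5
    with assms(1) obtain a b where "n dvd i - (a + b * k)" "\<bar>a\<bar> + \<bar>b\<bar> + (if b = 0 then 0 else 2) \<le> int l"
      by auto
    then show ?thesis unfolding 5 gp_reach.simps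
      by (intro exI[of _ a] exI[of _ b]) (auto split: if_splits)
  next
    case 6
    with assms(1) obtain a b where "n dvd i - (a + b * k)" "\<bar>a\<bar> + \<bar>b\<bar> + 1 \<le> int l"
      by auto
    then show ?thesis unfolding 6 gp_reach.simps
      by (intro exI[of _ a] exI[of _ b]) auto
  qed
qed

lemma relpow_imp_gp_reach: "(U 0, y) \<in> parcs (GP n k) ^^ l \<Longrightarrow> gp_reach n k l y"
proof (induction l arbitrary: y)
  case 0
  then show ?case by (auto intro!: exI[of _ 0])
next
  case (Suc l)
  then show ?case by (metis gp_reach_step relpow_Suc_E)
qed

text \<open>If \<open>b\<close> is nonzero, the two spokes add 2 to the cost \<open>F\<close>. If
  \<open>b = 0\<close>, no spokes are charged, and the cyclic distance from \<open>i\<close> to 0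
  must itself supply \<open>F + 2\<close>.\<close>

lemma GP_reach_cost:
  assumes "(U 0, U i) \<in> parcs (GP n k) ^^ l" "0 \<le> i" "i \<le> n" "F + 2 \<le> i" "F + 2 \<le> n - i"
    and "\<And>b t. F \<le> \<bar>i + t * n - b * k\<bar> + \<bar>b\<bar>"
  shows "F + 2 \<le> int l"
proof -
  obtain a b where "n dvd i - (a + b * k)"
    and l: "\<bar>a\<bar> + \<bar>b\<bar> + (if b = 0 then 0 else 2) \<le> int l"
    using relpow_imp_gp_reach[OF assms(1)] by auto
  then obtain t where "i - (a + b * k) = n * t" by (elim dvdE)
  then have a: "a = i + (- t) * n - b * k" by (simp add: algebra_simps)
  show ?thesis
  proof (cases "b = 0")
    case False
    with assms(6)[of "- t" b] a l show ?thesis by simp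
  next
    case True
    \<comment> \<open>For nonzero \<open>t\<close> the outer displacement is at least
      \<open>n - i\<close>; for \<open>t = 0\<close> it is \<open>i\<close>.\<close>
    have "t = 0 \<or> n \<le> \<bar>t * n\<bar>"
      using assms(2,3) mult_right_mono[of 1 "\<bar>t\<bar>" n] by (cases "t = 0") (auto simp: abs_mult)
    then have "F + 2 \<le> \<bar>i - t * n\<bar>" using assms(2-5) by auto
    with True a l show ?thesis by simp
  qed
qed

section \<open>Arithmetic: cost of the extremal residue\<close>

text \<open>With \<open>c = m - b\<close>, reaching \<open>m * k + s\<close> by \<open>b\<close>
  inner steps costs at least \<open>m + \<bar>s + c * k\<bar> - c\<close>. The hypotheses bound this
  at \<open>c = 1, 0, -1, -2\<close>; beyond these values it only grows, with slopes
  \<open>k - 1\<close> and \<open>k + 1\<close>.\<close>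

lemma line_cost:
  fixes k s G c :: int
  assumes "1 \<le> k" "G \<le> s + k - 1" "G \<le> \<bar>s\<bar>" "G \<le> \<bar>s - k\<bar> + 1" "G \<le> 2 * k + 2 - s"
  shows "G \<le> \<bar>s + c * k\<bar> - c"
proof -
  consider "c \<ge> 1" | "c = 0" | "c = - 1" | "c \<le> - 2" by linarith
  then show ?thesis
  proof cases
    case 1
    then have "0 \<le> (c - 1) * (k - 1)" using assms(1) by simp
    then have "s + k - 1 \<le> s + c * k - c" by (simp add: algebra_simps)
    with assms(2) show ?thesis by linarith
  next
    case 4
    then have "0 \<le> (- 2 - c) * (k + 1)" using assms(1) by simp
    then have "2 * k + 2 - s \<le> - (s + c * k) - c" by (simp add: algebra_simps)
    with assms(5) show ?thesis by linarith
  qed (use assms in auto)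
qed

text \<open>Going forward to the residue (\<open>t = 0\<close>) or backward from 0
  (\<open>t = - 1\<close>) are two instances of \<open>line_cost\<close>, with offsets
  \<open>s\<close> and \<open>J - s\<close>. Any other \<open>t\<close> needs a displacement of at
  least \<open>n + p\<close>; as a step covers at most \<open>k\<close>, this is too expensive by
  \<open>far\<close>.\<close>

lemma residue_cost:
  fixes n k m J G s b t :: int
  assumes "1 \<le> k" "n = 2 * m * k + J" "0 \<le> m * k + s" "2 * s \<le> J"
    and s: "G \<le> s + k - 1" "G \<le> \<bar>s\<bar>" "G \<le> \<bar>s - k\<bar> + 1" "G \<le> 2 * k + 2 - s"
    and s': "G \<le> \<bar>J - s\<bar>" "G \<le> \<bar>J - s - k\<bar> + 1" "G \<le> 2 * k + 2 - (J - s)"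
    and far: "k * (G - 1) < n + s"
  shows "m + G \<le> \<bar>m * k + s + t * n - b * k\<bar> + \<bar>b\<bar>"
proof -
  define p where "p = m * k + s"
  let ?x = "p + t * n"
  have i0: "0 \<le> p" "2 * p \<le> n" using assms(2-4) by (simp_all add: p_def algebra_simps)
  then have n0: "0 \<le> n" by linarith
  have far_cost: ?thesis if "n + p \<le> \<bar>?x\<bar>"
  proof -
    have "1 * \<bar>?x - b * k\<bar> \<le> k * \<bar>?x - b * k\<bar>" using assms(1) by (intro mult_right_mono) auto
    moreover have "\<bar>?x\<bar> \<le> \<bar>?x - b * k\<bar> + k * \<bar>b\<bar>"
      using abs_triangle_ineq[of "?x - b * k" "b * k"] assms(1) by (simp add: abs_mult mult.commute)
    ultimately have "\<bar>?x\<bar> \<le> k * (\<bar>?x - b * k\<bar> + \<bar>b\<bar>)" by (simp add: distrib_left)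
    moreover have "k * (m + G - 1) < n + p" using far by (simp add: p_def algebra_simps)
    ultimately have "k * (m + G - 1) < k * (\<bar>?x - b * k\<bar> + \<bar>b\<bar>)" using that by linarith
    then have "m + G - 1 < \<bar>?x - b * k\<bar> + \<bar>b\<bar>" using assms(1) by (simp add: mult_less_cancel_left_pos)
    then show ?thesis by (simp add: p_def)
  qed
  consider "t = 0" | "t = - 1" | "t \<ge> 1" | "t \<le> - 2" by linarith
  then show ?thesis
  proof cases
    case 1
    then have "?x - b * k = s + (m - b) * k" by (simp add: p_def algebra_simps)
    then show ?thesis using line_cost[OF assms(1) s, of "m - b"] unfolding p_def by linarith
  next
    case 2
    then have "?x - b * k = - ((J - s) + (m + b) * k)"
      using assms(2) by (simp add: p_def algebra_simps)
    \<comment> \<open>The remaining condition for the offset \<open>J - s\<close> is inherited from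
      \<open>s\<close>, because \<open>s \<le> J - s\<close>.\<close>
    moreover have "G \<le> J - s + k - 1" using s(1) assms(4) by linarith
    ultimately show ?thesis using line_cost[OF assms(1) _ s', of "m + b"] unfolding p_def by linarith
  next
    case 3
    then have "n \<le> t * n" using n0 mult_right_mono[of 1 t n] by simp
    then have "n + p \<le> \<bar>?x\<bar>" using i0 by linarith
    then show ?thesis by (rule far_cost)
  next
    case 4
    then have "t * n \<le> - 2 * n" using n0 by (intro mult_right_mono)
    then have "n + p \<le> \<bar>?x\<bar>" using i0 by linarith
    then show ?thesis by (rule far_cost)
  qed
qed

section \<open>Arithmetic: every residue is cheap enough\<close>

text \<open>Write \<open>y = (m - d) * k + r\<close>. The alternatives in \<open>near\<close> are
  the costs, less \<open>m\<close>, of rounding \<open>y\<close> down or up to a multiple of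
  \<open>k\<close>, and of approaching \<open>y - n\<close> with \<open>2 * m - q\<close> or
  \<open>2 * m - q + 1\<close> backward inner steps.\<close>

lemma cover_half:
  fixes n k m J G y :: int
  assumes "1 \<le> k" "n = 2 * m * k + J" "J < 2 * k" "0 \<le> y" "2 * y \<le> n"
    and near: "\<And>d r. 0 \<le> d \<Longrightarrow> 0 \<le> r \<Longrightarrow> r < k \<Longrightarrow> d = 0 \<longrightarrow> 2 * r \<le> J \<Longrightarrow>
      r - d \<le> G \<or> k + 1 - r - d \<le> G \<or> d + \<bar>J - r\<bar> \<le> G \<or> d + 1 + \<bar>J - r - k\<bar> \<le> G"
  shows "\<exists>a b. n dvd y - (a + b * k) \<and> \<bar>a\<bar> + \<bar>b\<bar> \<le> m + G"
proof -
  define q r where "q = y div k" and "r = y mod k"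
  define d where "d = m - q"
  have y: "y = q * k + r" and r: "0 \<le> r" "r < k" using assms(1) by (simp_all add: q_def r_def)
  have q: "0 \<le> q" using assms by (simp add: q_def pos_imp_zdiv_nonneg_iff)
  \<comment> \<open>Since \<open>J < 2 * k\<close>, the midpoint \<open>n / 2\<close> lies below
    \<open>(m + 1) * k\<close>; this gives \<open>0 \<le> d\<close>.\<close>
  have "q * k < (m + 1) * k" using assms(2,3,5) y r by (simp add: algebra_simps)
  then have "0 \<le> d" using assms(1) by (simp add: d_def)
  moreover have "2 * r \<le> J" if "d = 0"
    using assms(2,5) y that by (simp add: d_def algebra_simps)
  ultimately consider "r - d \<le> G" | "k + 1 - r - d \<le> G" | "d + \<bar>J - r\<bar> \<le> G"
    | "d + 1 + \<bar>J - r - k\<bar> \<le> G" using near r by blast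
  then show ?thesis
  proof cases
    case 1
    then show ?thesis using y q r by (intro exI[of _ r] exI[of _ q]) (simp add: d_def)
  next
    case 2
    then show ?thesis using y q r
      by (intro exI[of _ "r - k"] exI[of _ "q + 1"]) (simp add: d_def algebra_simps)
  next
    case 3
    have "y - (r - J + (q - 2 * m) * k) = n" using y assms(2) by (simp add: algebra_simps)
    then show ?thesis using 3 q \<open>0 \<le> d\<close>
      by (intro exI[of _ "r - J"] exI[of _ "q - 2 * m"]) (simp add: d_def)
  next
    case 4
    have "y - (r + k - J + (q - 2 * m - 1) * k) = n" using y assms(2) by (simp add: algebra_simps)
    then show ?thesis using 4 q \<open>0 \<le> d\<close>
      by (intro exI[of _ "r + k - J"] exI[of _ "q - 2 * m - 1"]) (simp add: d_def)
  qed
qed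

text \<open>Reflection \<open>y\<close> to \<open>n - y\<close> negates both coefficients and keeps
  the cost, so residues up to \<open>n / 2\<close> suffice.\<close>

lemma cover_all:
  fixes n k F x :: int
  assumes "0 < n" and half: "\<And>y. 0 \<le> y \<Longrightarrow> 2 * y \<le> n \<Longrightarrow>
      \<exists>a b. n dvd y - (a + b * k) \<and> \<bar>a\<bar> + \<bar>b\<bar> \<le> F"
  shows "\<exists>a b. n dvd x - (a + b * k) \<and> \<bar>a\<bar> + \<bar>b\<bar> \<le> F"
proof -
  define y where "y = x mod n"
  have y: "0 \<le> y" "y < n" "n dvd x - y" using assms(1) by (auto simp: y_def)
  show ?thesis
  proof (cases "2 * y \<le> n")
    case True
    with half y obtain a b where ab: "n dvd y - (a + b * k)" "\<bar>a\<bar> + \<bar>b\<bar> \<le> F" by blast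
    have "n dvd (x - y) + (y - (a + b * k))" using y ab by (intro dvd_add)
    moreover have "(x - y) + (y - (a + b * k)) = x - (a + b * k)" by simp
    ultimately have "n dvd x - (a + b * k)" by (simp only:)
    with ab show ?thesis by blast
  next
    case False
    then have "0 \<le> n - y" "2 * (n - y) \<le> n" using y by auto
    with half obtain a b where ab: "n dvd n - y - (a + b * k)" "\<bar>a\<bar> + \<bar>b\<bar> \<le> F" by blast
    have "n dvd (x - y) + n - (n - y - (a + b * k))" 
      by (intro dvd_diff[OF dvd_add[OF y(3) dvd_refl] ab(1)])
    moreover have "(x - y) + n - (n - y - (a + b * k)) = x - (- a + (- b) * k)" by simp
    ultimately have "n dvd x - (- a + (- b) * k)" by (simp only:)
    moreover have "\<bar>- a\<bar> + \<bar>- b\<bar> \<le> F" using ab by simp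
    ultimately show ?thesis by blast
  qed
qed

section \<open>Diameter from a value \<open>G\<close> and an extremal offset
  \<open>s\<close>\<close>

text \<open>\<open>near\<close> covers \<open>x = (m - d) k + r\<close>, using the multiples of \<open>k\<close> around \<open>x\<close> and around \<open>n - x\<close>;
  the conditions on \<open>s\<close> and \<open>J - s\<close> say that \<open>m k + s\<close> is no cheaper than \<open>m + G\<close>.\<close>

lemma diam_GP_eq:
  fixes n k h e m J G s :: int
  assumes k: "3 \<le> k" "2 * k < n" "k = 2 * h + e" "e = 0 \<or> e = 1"
    and size: "k * (k + e) \<le> 2 * n" "k = 3 \<longrightarrow> 8 \<le> n" "k = 4 \<longrightarrow> 10 \<le> n"
    and n: "n = 2 * m * k + J" and J: "0 \<le> J" "J < 2 * k"
    and G: "0 \<le> G" "2 * (G - 1) \<le> k - 2 + e"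
    and s: "G \<le> s + k - 1" "G \<le> \<bar>s\<bar>" "G \<le> \<bar>s - k\<bar> + 1" "G \<le> 2 * k + 2 - s"
      "G \<le> \<bar>J - s\<bar>" "G \<le> \<bar>J - s - k\<bar> + 1" "G \<le> 2 * k + 2 - (J - s)"
    and s_half: "- k < s" "2 * s \<le> J"
    and s_mid: "G + 3 \<le> s + k \<or> G + 4 \<le> s + 2 * k \<and> J < k - 2 + e"
    and near: "\<And>d r. 0 \<le> d \<Longrightarrow> 0 \<le> r \<Longrightarrow> r < k \<Longrightarrow> d = 0 \<longrightarrow> 2 * r \<le> J \<Longrightarrow>
      r - d \<le> G \<or> k + 1 - r - d \<le> G \<or> d + \<bar>J - r\<bar> \<le> G \<or> d + 1 + \<bar>J - r - k\<bar> \<le> G"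
  shows "diam (with_proj (GP n k)) = ereal (real_of_int (m + G + 2))"
proof -
  have m: "1 \<le> m"
  proof -
    have "0 < m * k" using k(2) n J(2) by simp
    then show ?thesis using k(1) by (simp add: zero_less_mult_iff)
  qed
  \<comment> \<open>For \<open>k \<ge> 5\<close> a smaller \<open>J\<close> contradicts the
    quadratic size bound through \<open>(k - 5) * (k - 1) \<ge> 0\<close>. For \<open>k = 3\<close>
    and \<open>k = 4\<close> the claim is exactly \<open>n \<ge> 8\<close> and
    \<open>n \<ge> 10\<close>.\<close>
  have small: "k - 2 + e \<le> J" if "m = 1"
  proof (rule ccontr)
    assume *: "\<not> k - 2 + e \<le> J"
    have n': "n = 2 * k + J" using n that by simp
    have "k \<le> 4"
    proof (rule ccontr)
      assume "\<not> k \<le> 4"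
      then have "0 \<le> (k - 5) * (k - 1)" by simp
      then have "6 * k - 5 \<le> k * k" by (simp add: algebra_simps)
      then show False using * n' size(1) k(1,4) by (auto simp: algebra_simps)
    qed
    then have "k = 3 \<and> e = 1 \<or> k = 4 \<and> e = 0" using k by presburger
    then show False using * n' size by auto
  qed
  have mk: "m + k - 1 \<le> m * k"
  proof -
    have "0 \<le> (m - 1) * (k - 1)" using m k by simp
    then show ?thesis by (simp add: algebra_simps)
  qed
  have mk2: "m + 2 * k - 2 \<le> m * k" if "m \<noteq> 1"
  proof -
    have "0 \<le> (m - 2) * (k - 1)" using m k that by simp
    then show ?thesis by (simp add: algebra_simps)
  qed
  \<comment> \<open>The first alternative of \<open>s_mid\<close> combines with \<open>mk\<close>.
    The second forces \<open>m \<noteq> 1\<close> by \<open>small\<close>, so the stronger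
    \<open>mk2\<close> applies.\<close>
  have i: "m + G + 2 \<le> m * k + s"
    using s_mid mk mk2 small by linarith
  have "m * k + s \<le> n - (m * k + s)" using s_half(2) n by (simp add: algebra_simps)
  then have i': "m + G + 2 \<le> n - (m * k + s)" using i by linarith
  have "0 < n" using k by simp
  \<comment> \<open>The bound on \<open>G\<close> and the size hypothesis give
    \<open>k * (G - 1) \<le> n - k\<close>, and \<open>- k < s\<close> makes the comparison with
    \<open>n + s\<close> strict.\<close>
  have "k * (2 * (G - 1)) \<le> k * (k - 2 + e)"
    using k(1) by (intro mult_left_mono[OF G(2)]) simp
  then have far: "k * (G - 1) < n + s" using size(1) s_half(1) by (simp add: algebra_simps)
  have wf: "wf_digraph (with_proj (GP n k))"
    using pair_graph_GP[of n k] k by (simp add: wf_digraph_wp_iff pair_graph_def pair_digraph_def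
      pair_fin_digraph_def)
  have "diam (with_proj (GP n k)) = ereal (real (nat (m + G + 2)))"
  proof (rule diam_eqI[OF wf])
    fix x y assume "x \<in> pverts (GP n k)" "y \<in> pverts (GP n k)"
    moreover have "\<exists>a b. n dvd z - (a + b * k) \<and> \<bar>a\<bar> + \<bar>b\<bar> \<le> m + G" for z
      by (rule cover_all[OF \<open>0 < n\<close>]) (rule cover_half[OF _ n J(2) _ _ near], use k in auto)
    ultimately show "\<exists>l\<le>nat (m + G + 2). (x, y) \<in> parcs (GP n k) ^^ l"
      using GP_walk_length[OF \<open>0 < n\<close>, of x y k "m + G"] by (simp add: GP_simps)
  next
    show "U 0 \<in> pverts (GP n k)" "U (m * k + s) \<in> pverts (GP n k)"
      using \<open>0 < n\<close> i i' m G by (auto simp: GP_simps gp_verts_def)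
    fix l assume l: "(U 0, U (m * k + s)) \<in> parcs (GP n k) ^^ l"
    have "m + G \<le> \<bar>m * k + s + t * n - b * k\<bar> + \<bar>b\<bar>" for b t
      using residue_cost[OF _ n _ s_half(2) s far] i k(1) m G(1) by simp
    then have "m + G + 2 \<le> int l"
      using GP_reach_cost[OF l _ _ i i'] i i' m G(1) by simp
    then show "nat (m + G + 2) \<le> l" by linarith
  qed
  then show ?thesis using m G by simp
qed

section \<open>Choice of \<open>G\<close> and \<open>s\<close> in the eight residue ranges\<close>

theorem theorem3p1:
  fixes n k :: int
  assumes "3 \<le> k" and "real_of_int k < real_of_int n / 2"
    and "k = 3 \<Longrightarrow> n \<ge> 8"
    and "k = 4 \<Longrightarrow> n \<ge> 10"
    and "odd k \<and> k \<ge> 5 \<Longrightarrow> real_of_int n \<ge> real_of_int (k * (k + 1)) / 2"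
    and "even k \<and> k \<ge> 6 \<Longrightarrow> real_of_int n \<ge> real_of_int (k\<^sup>2) / 2"
  shows
    "(\<forall>m j :: int. m \<ge> 0 \<and> k \<ge> 3 \<and> odd k \<and> even n \<and> real_of_int n / 2 = real_of_int (m * k + j) \<and>
        real_of_int (k - 1) / 2 \<le> real_of_int j \<and> j < k \<longrightarrow>
        (real_of_int j = real_of_int (k - 1) / 2 \<or> real_of_int j = real_of_int (k + 1) / 2 \<longrightarrow>
          diam (with_proj (GP n k)) = ereal (real_of_int (m + 2 + j))) \<and>
        (3 \<le> 2 * j - k \<and> real_of_int (2 * j - k) \<le> real_of_int (k + 1) / 2 \<longrightarrow>
          diam (with_proj (GP n k)) = ereal (real_of_int (m + 3 + k - j))) \<and>
        (real_of_int (2 * j - k) > real_of_int (k + 1) / 2 \<longrightarrow>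
          diam (with_proj (GP n k)) = ereal (real_of_int (m + 2 + j) - real_of_int (k - 1) / 2)))
   \<and> (\<forall>m j :: int. m \<ge> 0 \<and> k \<ge> 3 \<and> odd k \<and> even n \<and> real_of_int n / 2 = real_of_int (m * k + j) \<and>
        0 \<le> j \<and> real_of_int j < real_of_int (k - 1) / 2 \<longrightarrow>
        (j = 0 \<or> j = 1 \<longrightarrow>
          diam (with_proj (GP n k)) = ereal (real_of_int (m + 1) + real_of_int (k + 1) / 2)) \<and>
        (4 \<le> 2 * j \<and> real_of_int (2 * j) \<le> real_of_int (k + 1) / 2 \<longrightarrow>
          diam (with_proj (GP n k)) = ereal (real_of_int (m + 3) + real_of_int (k - 1) / 2 - real_of_int j)) \<and>
        (real_of_int (2 * j) > real_of_int (k + 1) / 2 \<longrightarrow>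
          diam (with_proj (GP n k)) = ereal (real_of_int (m + 2 + j))))
   \<and> (\<forall>m j :: int. m \<ge> 0 \<and> k \<ge> 3 \<and> odd k \<and> odd n \<and> real_of_int (n - 1) / 2 = real_of_int (m * k + j) \<and>
        real_of_int (k - 2) / 2 \<le> real_of_int j \<and> j < k \<longrightarrow>
        (real_of_int j = real_of_int (k - 1) / 2 \<longrightarrow>
          diam (with_proj (GP n k)) = ereal (real_of_int (m + 2) + real_of_int (k - 1) / 2)) \<and>
        (2 \<le> 2 * j + 1 - k \<and> real_of_int (2 * j + 1 - k) \<le> real_of_int (k + 1) / 2 \<longrightarrow>
          diam (with_proj (GP n k)) = ereal (real_of_int (m + 2 + k - j))) \<and>
        (real_of_int (2 * j + 1 - k) > real_of_int (k + 1) / 2 \<longrightarrow>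
          diam (with_proj (GP n k)) = ereal (real_of_int (m + 2 + j) - real_of_int (k - 1) / 2)))
   \<and> (\<forall>m j :: int. m \<ge> 0 \<and> k \<ge> 3 \<and> odd k \<and> odd n \<and> real_of_int (n - 1) / 2 = real_of_int (m * k + j) \<and>
        0 \<le> j \<and> real_of_int j < real_of_int (k - 2) / 2 \<longrightarrow>
        (1 \<le> 2 * j + 1 \<and> real_of_int (2 * j + 1) \<le> real_of_int (k + 1) / 2 \<longrightarrow>
          diam (with_proj (GP n k)) = ereal (real_of_int (m + 2) + real_of_int (k - 1) / 2 - real_of_int j)) \<and>
        (real_of_int (2 * j + 1) > real_of_int (k + 1) / 2 \<longrightarrow>
          diam (with_proj (GP n k)) = ereal (real_of_int (m + 2 + j))))
   \<and> (\<forall>m j :: int. m \<ge> 0 \<and> k \<ge> 4 \<and> even k \<and> even n \<and> real_of_int n / 2 = real_of_int (m * k + j) \<and>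
        real_of_int (k - 2) / 2 \<le> real_of_int j \<and> j < k \<longrightarrow>
        (real_of_int j = real_of_int (k - 2) / 2 \<or> real_of_int j = real_of_int k / 2 \<longrightarrow>
          diam (with_proj (GP n k)) = ereal (real_of_int (m + 2 + j))) \<and>
        (2 \<le> 2 * j - k \<and> real_of_int (2 * j - k) \<le> real_of_int k / 2 \<longrightarrow>
          diam (with_proj (GP n k)) = ereal (real_of_int (m + 3 + k - j))) \<and>
        (real_of_int (2 * j - k) \<ge> real_of_int (k + 2) / 2 \<longrightarrow>
          diam (with_proj (GP n k)) = ereal (real_of_int (m + 2 + j) - real_of_int k / 2)))
   \<and> (\<forall>m j :: int. m \<ge> 0 \<and> k \<ge> 4 \<and> even k \<and> even n \<and> real_of_int n / 2 = real_of_int (m * k + j) \<and>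
        0 \<le> j \<and> real_of_int j < real_of_int (k - 2) / 2 \<longrightarrow>
        (j = 0 \<longrightarrow>
          diam (with_proj (GP n k)) = ereal (real_of_int (m + 1) + real_of_int k / 2)) \<and>
        (2 \<le> 2 * j \<and> real_of_int (2 * j) \<le> real_of_int k / 2 \<longrightarrow>
          diam (with_proj (GP n k)) = ereal (real_of_int (m + 2) + real_of_int k / 2 - real_of_int j)) \<and>
        (real_of_int (2 * j) \<ge> real_of_int (k + 2) / 2 \<longrightarrow>
          diam (with_proj (GP n k)) = ereal (real_of_int (m + 2 + j))))
   \<and> (\<forall>m j :: int. m \<ge> 0 \<and> k \<ge> 4 \<and> even k \<and> odd n \<and> real_of_int (n - 1) / 2 = real_of_int (m * k + j) \<and>
        real_of_int (k - 3) / 2 \<le> real_of_int j \<and> j < k \<longrightarrow>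
        (real_of_int j = real_of_int (k - 2) / 2 \<longrightarrow>
          diam (with_proj (GP n k)) = ereal (real_of_int (m + 2) + real_of_int (k - 2) / 2)) \<and>
        (1 \<le> 2 * j + 1 - k \<and> real_of_int (2 * j + 1 - k) \<le> real_of_int k / 2 \<longrightarrow>
          diam (with_proj (GP n k)) = ereal (real_of_int (m + 2 + k - j))) \<and>
        (real_of_int (2 * j + 1 - k) \<ge> real_of_int (k + 2) / 2 \<longrightarrow>
          diam (with_proj (GP n k)) = ereal (real_of_int (m + 3 + j) - real_of_int k / 2)))
   \<and> (\<forall>m j :: int. m \<ge> 0 \<and> k \<ge> 4 \<and> even k \<and> odd n \<and> real_of_int (n - 1) / 2 = real_of_int (m * k + j) \<and>
        0 \<le> j \<and> real_of_int j < real_of_int (k - 3) / 2 \<longrightarrow>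
        (j = 0 \<longrightarrow>
          diam (with_proj (GP n k)) = ereal (real_of_int (m + 1) + real_of_int k / 2)) \<and>
        (3 \<le> 2 * j + 1 \<and> real_of_int (2 * j + 1) \<le> real_of_int k / 2 \<longrightarrow>
          diam (with_proj (GP n k)) = ereal (real_of_int (m + 2) + real_of_int k / 2 - real_of_int j)) \<and>
        (real_of_int (2 * j + 1) \<ge> real_of_int (k + 2) / 2 \<longrightarrow>
          diam (with_proj (GP n k)) = ereal (real_of_int (m + 2 + j))))"
proof -
  have kn: "2 * k < n" using assms(2) by linarith
  have odd_size: "k * (k + 1) \<le> 2 * n" if "odd k"
  proof (cases "k = 3")
    case False
    with that assms(1) have "k \<ge> 5" by presburger
    with assms(5) that have "real_of_int (k * (k + 1)) \<le> real_of_int (2 * n)" by simp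
    then show ?thesis by (simp only: of_int_le_iff)
  qed (use assms(3) in simp)
  \<comment> \<open>The form \<open>k + 0\<close> lets unification set \<open>e\<close> to 0 below,
    just as \<open>k + 1\<close> sets it to 1.\<close>
  have even_size: "k * (k + 0) \<le> 2 * n" if "even k"
  proof (cases "k = 4")
    case False
    with that assms(1) have "k \<ge> 6" by presburger
    with assms(6) that have "real_of_int (k * (k + 0)) \<le> real_of_int (2 * n)"
      by (simp add: power2_eq_square)
    then show ?thesis by (simp only: of_int_le_iff)
  qed (use assms(4) in simp)
  have small: "k = 3 \<longrightarrow> 8 \<le> n" "k = 4 \<longrightarrow> 10 \<le> n" using assms(3,4) by simp_all
  note odd_diam = diam_GP_eq[OF assms(1) kn _ _ odd_size small]
  note even_diam = diam_GP_eq[OF assms(1) kn _ _ even_size small]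
  let ?D = "diam (with_proj (GP n k))"
  \<comment> \<open>Each claim has the shape \<open>m + G + 2\<close>, so \<open>G\<close> is read
    off by unification and only \<open>s\<close> and \<open>h\<close> are supplied. The goals left
    over, including \<open>near\<close>, are linear in \<open>h\<close>, \<open>j\<close>,
    \<open>d\<close> and \<open>r\<close>.\<close>
  have part1: "(j = h \<or> j = h + 1 \<longrightarrow> ?D = ereal (real_of_int (m + j + 2))) \<and>
      (3 \<le> 2 * j - k \<and> 2 * j - k \<le> h + 1 \<longrightarrow> ?D = ereal (real_of_int (m + (1 + k - j) + 2))) \<and>
      (h + 1 < 2 * j - k \<longrightarrow> ?D = ereal (real_of_int (m + (j - h) + 2)))"
    if "k = 2 * h + 1" "n = 2 * m * k + (2 * j)" "h \<le> j" "j < k" for m j h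
  proof (intro conjI impI)
    assume c: "j = h \<or> j = h + 1"
    show "?D = ereal (real_of_int (m + j + 2))"
      by (rule odd_diam[OF _ _ _ that(2), where s = "j" and h = h];
        use that(1,3,4) c assms(1) in \<open>(linarith | presburger)\<close>)
  next
    \<comment> \<open>Here \<open>s = j\<close> is the antipode \<open>n / 2\<close>, which is
      cheapest from \<open>(m + 1) * k\<close>, at cost \<open>m + 1 + k - j\<close>.\<close>
    assume c: "3 \<le> 2 * j - k \<and> 2 * j - k \<le> h + 1"
    show "?D = ereal (real_of_int (m + (1 + k - j) + 2))"
      by (rule odd_diam[OF _ _ _ that(2), where s = "j" and h = h];
        use that(1,3,4) c assms(1) in \<open>(linarith | presburger)\<close>)
  next
    \<comment> \<open>A balanced choice: the residue lies \<open>G\<close> beyond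
      \<open>m * k\<close>, and its reflection lies \<open>G - 1\<close> beyond
      \<open>(m + 1) * k\<close>; both cost \<open>m + G\<close>.\<close>
    assume c: "h + 1 < 2 * j - k"
    show "?D = ereal (real_of_int (m + (j - h) + 2))"
      by (rule odd_diam[OF _ _ _ that(2), where s = "j - h" and h = h];
        use that(1,3,4) c assms(1) in \<open>(linarith | presburger)\<close>)
  qed
  have part2: "(j = 0 \<or> j = 1 \<longrightarrow> ?D = ereal (real_of_int (m + h + 2))) \<and>
      (4 \<le> 2 * j \<and> 2 * j \<le> h + 1 \<longrightarrow> ?D = ereal (real_of_int (m + (1 + h - j) + 2))) \<and>
      (h + 1 < 2 * j \<longrightarrow> ?D = ereal (real_of_int (m + j + 2)))"
    if "k = 2 * h + 1" "n = 2 * m * k + (2 * j)" "0 \<le> j" "j < h" for m j h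
  proof (intro conjI impI)
    \<comment> \<open>The residue \<open>m * k - h\<close> ties between \<open>m * k\<close> and
      \<open>(m - 1) * k\<close>. Here \<open>s_mid\<close> holds through its second
      alternative.\<close>
    assume c: "j = 0 \<or> j = 1"
    show "?D = ereal (real_of_int (m + h + 2))"
      by (rule odd_diam[OF _ _ _ that(2), where s = "- h" and h = h];
        use that(1,3,4) c assms(1) in \<open>(linarith | presburger)\<close>)
  next
    \<comment> \<open>Balanced below the multiples: the residue is \<open>m * k - G\<close> and its
      reflection is \<open>(m + 1) * k - (G - 1)\<close>.\<close>
    assume c: "4 \<le> 2 * j \<and> 2 * j \<le> h + 1"
    show "?D = ereal (real_of_int (m + (1 + h - j) + 2))"
      by (rule odd_diam[OF _ _ _ that(2), where s = "- (1 + h - j)" and h = h];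
        use that(1,3,4) c assms(1) in \<open>(linarith | presburger)\<close>)
  next
    assume c: "h + 1 < 2 * j"
    show "?D = ereal (real_of_int (m + j + 2))"
      by (rule odd_diam[OF _ _ _ that(2), where s = "j" and h = h];
        use that(1,3,4) c assms(1) in \<open>(linarith | presburger)\<close>)
  qed
  have part3: "(j = h \<longrightarrow> ?D = ereal (real_of_int (m + h + 2))) \<and>
      (2 \<le> 2 * j + 1 - k \<and> 2 * j + 1 - k \<le> h + 1 \<longrightarrow> ?D = ereal (real_of_int (m + (k - j) + 2))) \<and>
      (h + 1 < 2 * j + 1 - k \<longrightarrow> ?D = ereal (real_of_int (m + (j - h) + 2)))"
    if "k = 2 * h + 1" "n = 2 * m * k + (2 * j + 1)" "h \<le> j" "j < k" for m j h
  proof (intro conjI impI)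
    assume c: "j = h"
    show "?D = ereal (real_of_int (m + h + 2))"
      by (rule odd_diam[OF _ _ _ that(2), where s = "h" and h = h];
        use that(1,3,4) c assms(1) in \<open>(linarith | presburger)\<close>)
  next
    \<comment> \<open>For odd \<open>n\<close> the reflection has offset \<open>j + 1\<close>, so
      rounding it up to \<open>(m + 1) * k\<close> saves one step compared with the residue
      itself.\<close>
    assume c: "2 \<le> 2 * j + 1 - k \<and> 2 * j + 1 - k \<le> h + 1"
    show "?D = ereal (real_of_int (m + (k - j) + 2))"
      by (rule odd_diam[OF _ _ _ that(2), where s = "j" and h = h];
        use that(1,3,4) c assms(1) in \<open>(linarith | presburger)\<close>)
  next
    assume c: "h + 1 < 2 * j + 1 - k"
    show "?D = ereal (real_of_int (m + (j - h) + 2))"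
      by (rule odd_diam[OF _ _ _ that(2), where s = "j - h" and h = h];
        use that(1,3,4) c assms(1) in \<open>(linarith | presburger)\<close>)
  qed
  have part4: "(2 * j + 1 \<le> h + 1 \<longrightarrow> ?D = ereal (real_of_int (m + (h - j) + 2))) \<and>
      (h + 1 < 2 * j + 1 \<longrightarrow> ?D = ereal (real_of_int (m + j + 2)))"
    if "k = 2 * h + 1" "n = 2 * m * k + (2 * j + 1)" "0 \<le> j" "j < h" for m j h
  proof (intro conjI impI)
    assume c: "2 * j + 1 \<le> h + 1"
    show "?D = ereal (real_of_int (m + (h - j) + 2))"
      by (rule odd_diam[OF _ _ _ that(2), where s = "- (h - j)" and h = h];
        use that(1,3,4) c assms(1) in \<open>(linarith | presburger)\<close>)
  next
    assume c: "h + 1 < 2 * j + 1"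
    show "?D = ereal (real_of_int (m + j + 2))"
      by (rule odd_diam[OF _ _ _ that(2), where s = "j" and h = h];
        use that(1,3,4) c assms(1) in \<open>(linarith | presburger)\<close>)
  qed
  have part5: "(j = h - 1 \<or> j = h \<longrightarrow> ?D = ereal (real_of_int (m + j + 2))) \<and>
      (2 \<le> 2 * j - k \<and> 2 * j - k \<le> h \<longrightarrow> ?D = ereal (real_of_int (m + (1 + k - j) + 2))) \<and>
      (h + 1 \<le> 2 * j - k \<longrightarrow> ?D = ereal (real_of_int (m + (j - h) + 2)))"
    if "k = 2 * h" "n = 2 * m * k + (2 * j)" "h - 1 \<le> j" "j < k" for m j h
  proof (intro conjI impI)
    assume c: "j = h - 1 \<or> j = h"
    show "?D = ereal (real_of_int (m + j + 2))"
      by (rule even_diam[OF _ _ _ that(2), where s = "j" and h = h];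
        use that(1,3,4) c assms(1) in \<open>(linarith | presburger)\<close>)
  next
    assume c: "2 \<le> 2 * j - k \<and> 2 * j - k \<le> h"
    show "?D = ereal (real_of_int (m + (1 + k - j) + 2))"
      by (rule even_diam[OF _ _ _ that(2), where s = "j" and h = h];
        use that(1,3,4) c assms(1) in \<open>(linarith | presburger)\<close>)
  next
    assume c: "h + 1 \<le> 2 * j - k"
    show "?D = ereal (real_of_int (m + (j - h) + 2))"
      by (rule even_diam[OF _ _ _ that(2), where s = "j - h" and h = h];
        use that(1,3,4) c assms(1) in \<open>(linarith | presburger)\<close>)
  qed
  have part6: "(j = 0 \<longrightarrow> ?D = ereal (real_of_int (m + (h - 1) + 2))) \<and>
      (2 \<le> 2 * j \<and> 2 * j \<le> h \<longrightarrow> ?D = ereal (real_of_int (m + (h - j) + 2))) \<and>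
      (h + 1 \<le> 2 * j \<longrightarrow> ?D = ereal (real_of_int (m + j + 2)))"
    if "k = 2 * h" "n = 2 * m * k + (2 * j)" "0 \<le> j" "j < h - 1" for m j h
  proof (intro conjI impI)
    \<comment> \<open>For even \<open>k\<close> the midpoint \<open>m * k - h\<close> is reached
      from \<open>(m - 1) * k\<close> at cost \<open>m - 1 + h\<close>; hence \<open>G\<close> is
      \<open>h - 1\<close>.\<close>
    assume c: "j = 0"
    show "?D = ereal (real_of_int (m + (h - 1) + 2))"
      by (rule even_diam[OF _ _ _ that(2), where s = "- (h - 1)" and h = h];
        use that(1,3,4) c assms(1) in \<open>(linarith | presburger)\<close>)
  next
    assume c: "2 \<le> 2 * j \<and> 2 * j \<le> h"
    show "?D = ereal (real_of_int (m + (h - j) + 2))"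
      by (rule even_diam[OF _ _ _ that(2), where s = "- (h - j)" and h = h];
        use that(1,3,4) c assms(1) in \<open>(linarith | presburger)\<close>)
  next
    assume c: "h + 1 \<le> 2 * j"
    show "?D = ereal (real_of_int (m + j + 2))"
      by (rule even_diam[OF _ _ _ that(2), where s = "j" and h = h];
        use that(1,3,4) c assms(1) in \<open>(linarith | presburger)\<close>)
  qed
  have part7: "(j = h - 1 \<longrightarrow> ?D = ereal (real_of_int (m + (h - 1) + 2))) \<and>
      (1 \<le> 2 * j + 1 - k \<and> 2 * j + 1 - k \<le> h \<longrightarrow> ?D = ereal (real_of_int (m + (k - j) + 2))) \<and>
      (h + 1 \<le> 2 * j + 1 - k \<longrightarrow> ?D = ereal (real_of_int (m + (1 + j - h) + 2)))"
    if "k = 2 * h" "n = 2 * m * k + (2 * j + 1)" "h - 1 \<le> j" "j < k" for m j h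
  proof (intro conjI impI)
    assume c: "j = h - 1"
    show "?D = ereal (real_of_int (m + (h - 1) + 2))"
      by (rule even_diam[OF _ _ _ that(2), where s = "h - 1" and h = h];
        use that(1,3,4) c assms(1) in \<open>(linarith | presburger)\<close>)
  next
    assume c: "1 \<le> 2 * j + 1 - k \<and> 2 * j + 1 - k \<le> h"
    show "?D = ereal (real_of_int (m + (k - j) + 2))"
      by (rule even_diam[OF _ _ _ that(2), where s = "j" and h = h];
        use that(1,3,4) c assms(1) in \<open>(linarith | presburger)\<close>)
  next
    \<comment> \<open>The extra 1 restores the balance for odd \<open>n\<close> and even
      \<open>k\<close>: the reflection has offset \<open>k + s - 1\<close>, so both sides cost
      \<open>m + s\<close>.\<close>
    assume c: "h + 1 \<le> 2 * j + 1 - k"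
    show "?D = ereal (real_of_int (m + (1 + j - h) + 2))"
      by (rule even_diam[OF _ _ _ that(2), where s = "1 + j - h" and h = h];
        use that(1,3,4) c assms(1) in \<open>(linarith | presburger)\<close>)
  qed
  have part8: "(j = 0 \<longrightarrow> ?D = ereal (real_of_int (m + (h - 1) + 2))) \<and>
      (3 \<le> 2 * j + 1 \<and> 2 * j + 1 \<le> h \<longrightarrow> ?D = ereal (real_of_int (m + (h - j) + 2))) \<and>
      (h + 1 \<le> 2 * j + 1 \<longrightarrow> ?D = ereal (real_of_int (m + j + 2)))"
    if "k = 2 * h" "n = 2 * m * k + (2 * j + 1)" "0 \<le> j" "j < h - 1" for m j h
  proof (intro conjI impI)
    assume c: "j = 0"
    show "?D = ereal (real_of_int (m + (h - 1) + 2))"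
      by (rule even_diam[OF _ _ _ that(2), where s = "- (h - 1)" and h = h];
        use that(1,3,4) c assms(1) in \<open>(linarith | presburger)\<close>)
  next
    assume c: "3 \<le> 2 * j + 1 \<and> 2 * j + 1 \<le> h"
    show "?D = ereal (real_of_int (m + (h - j) + 2))"
      by (rule even_diam[OF _ _ _ that(2), where s = "- (h - j)" and h = h];
        use that(1,3,4) c assms(1) in \<open>(linarith | presburger)\<close>)
  next
    assume c: "h + 1 \<le> 2 * j + 1"
    show "?D = ereal (real_of_int (m + j + 2))"
      by (rule even_diam[OF _ _ _ that(2), where s = "j" and h = h];
        use that(1,3,4) c assms(1) in \<open>(linarith | presburger)\<close>)
  qed
  have half_even: "n = 2 * m * k + 2 * j" if "real_of_int n / 2 = real_of_int (m * k + j)" for m j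
  proof -
    have "real_of_int n = real_of_int (2 * m * k + 2 * j)" using that by simp
    then show ?thesis by (simp only: of_int_eq_iff)
  qed
  have half_odd: "n = 2 * m * k + (2 * j + 1)"
    if "real_of_int (n - 1) / 2 = real_of_int (m * k + j)" for m j
  proof -
    have "real_of_int n = real_of_int (2 * m * k + (2 * j + 1))" using that by simp
    then show ?thesis by (simp only: of_int_eq_iff)
  qed
  show ?thesis
  proof ((intro conjI; intro allI impI; elim conjE), goal_cases)
    case (1 m j)
    then obtain h where h: "k = 2 * h + 1" by (elim oddE)
    have "h \<le> j" "j < k" using 1(6,7) by (auto simp: h field_simps)
    note part = part1[OF h half_even[OF 1(5)] this]
    show ?case using part by (auto simp: h field_simps)
  next
    case (2 m j)
    then obtain h where h: "k = 2 * h + 1" by (elim oddE)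
    have "0 \<le> j" "j < h" using 2(6,7) by (auto simp: h field_simps)
    note part = part2[OF h half_even[OF 2(5)] this]
    show ?case using part by (auto simp: h field_simps)
  next
    case (3 m j)
    then obtain h where h: "k = 2 * h + 1" by (elim oddE)
    \<comment> \<open>The bound \<open>(k - 2) / 2 = h - 1 / 2\<close> is a half-integer, so
      integrality of \<open>j\<close> rounds it up to \<open>h\<close>. The odd-\<open>n\<close>
      cases with even \<open>k\<close> round \<open>(k - 3) / 2\<close> in the same way.\<close>
    have "h \<le> j" "j < k" using 3(6,7) by (auto simp: h field_simps)
    note part = part3[OF h half_odd[OF 3(5)] this]
    show ?case using part by (auto simp: h field_simps)
  next
    case (4 m j)
    then obtain h where h: "k = 2 * h + 1" by (elim oddE)
    have "0 \<le> j" "j < h" using 4(6,7) by (auto simp: h field_simps)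
    note part = part4[OF h half_odd[OF 4(5)] this]
    show ?case using part by (auto simp: h field_simps)
  next
    case (5 m j)
    then obtain h where h: "k = 2 * h" by (elim evenE)
    have "h - 1 \<le> j" "j < k" using 5(6,7) by (auto simp: h field_simps)
    note part = part5[OF h half_even[OF 5(5)] this]
    show ?case using part by (auto simp: h field_simps)
  next
    case (6 m j)
    then obtain h where h: "k = 2 * h" by (elim evenE)
    have "0 \<le> j" "j < h - 1" using 6(6,7) by (auto simp: h field_simps)
    note part = part6[OF h half_even[OF 6(5)] this]
    show ?case using part by (auto simp: h field_simps)
  next
    case (7 m j)
    then obtain h where h: "k = 2 * h" by (elim evenE)
    have "h - 1 \<le> j" "j < k" using 7(6,7) by (auto simp: h field_simps)
    note part = part7[OF h half_odd[OF 7(5)] this]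
    show ?case using part by (auto simp: h field_simps)
  next
    case (8 m j)
    then obtain h where h: "k = 2 * h" by (elim evenE)
    have "0 \<le> j" "j < h - 1" using 8(6,7) by (auto simp: h field_simps)
    note part = part8[OF h half_odd[OF 8(5)] this]
    show ?case using part by (auto simp: h field_simps)
  qed
qed

end
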